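(* Let $\alpha_1,\dots,\alpha_M>0$, let $Z_1,\dots,Z_M$ be symmetric positive definite with $Z_j\in\mathbb R^{n_j\times n_j}$, and let $i\in\mathcal M$, $A_{\mathcal N_i}\in\mathbb R^{n_i\times n_{\mathcal N_i}}$, $B_i\in\mathbb R^{n_i\times m_i}$, $K_{\mathcal N_i}\in\mathbb R^{m_i\times n_{\mathcal N_i}}$. The condition $$(A_{\mathcal N_i}+B_iK_{\mathcal N_i})x_{\mathcal N_i}\in\widehat{\mathcal X}_{f,i}(\alpha_i)\quad\text{for all } x_{\mathcal N_i}\in\widehat{\mathcal X}_{f,\mathcal N_i}(\alpha_{\mathcal N_i})$$ holds if there exist scalars $\lambda_{ij}\ge 0$, $j\in\mathcal N_i$, such that $$\begin{bmatrix} Z_i^{-1}\alpha_i^{1/2} & A_{\mathcal N_i}\alpha_{\mathcal N_i}^{1/2}+B_iK_{\mathcal N_i}\alpha_{\mathcal N_i}^{1/2}\\ (A_{\mathcal N_i}\alpha_{\mathcal N_i}^{1/2}+B_iK_{\mathcal N_i}\alpha_{\mathcal N_i}^{1/2})^\top & \sum_{j\in\mathcal N_i}\lambda_{ij}Z_{ij}\end{bmatrix}\succeq 0\quad\text{and}\quad \sum_{j\in\mathcal N_i}\lambda_{ij}\le\alpha_i^{1/2}.$$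
   Context: Setting: $\mathcal M=\{1,\dots,M\}$ indexes subsystems; $x=[x_1^\top,\dots,x_M^\top]^\top\in\mathbb R^n$ with $x_i\in\mathbb R^{n_i}$. For each $i$, $\mathcal N_i\subseteq\mathcal M$ is the set of neighbors of subsystem $i$ (those whose states affect subsystem $i$), and $x_{\mathcal N_i}\in\mathbb R^{n_{\mathcal N_i}}$ is the concatenation of the $x_j$, $j\in\mathcal N_i$. $U_i\in\{0,1\}^{n_i\times n}$ and $W_{\mathcal N_i}\in\{0,1\}^{n_{\mathcal N_i}\times n}$ are the selection matrices with $x_i=U_ix$ and $x_{\mathcal N_i}=W_{\mathcal N_i}x$. Subsystem $i$ has dynamics $x_{i,t+1}=A_{\mathcal N_i}x_{\mathcal N_i,t}+B_iu_{i,t}$ with input $u_{i,t}\in\mathbb R^{m_i}$, and $u_i=K_{\mathcal N_i}x_{\mathcal N_i}$ is a linear terminal controller. Terminal sets: $\widehat{\mathcal X}_{f,i}(\alpha_i)=\{x_i\in\mathbb R^{n_i}: x_i^\top Z_ix_i\le\alpha_i\}$ and $\widehat{\mathcal X}_{f,\mathcal N_i}(\alpha_{\mathcal N_i})$ is the product of the sets $\widehat{\mathcal X}_{f,j}(\alpha_j)$ over $j\in\mathcal N_i$. Notation: $\alpha=\mathrm{diag}(\alpha_1I_{n_1},\dots,\alpha_MI_{n_M})$ (block diagonal), $\alpha_{\mathcal N_i}=W_{\mathcal N_i}\alpha W_{\mathcal N_i}^\top$, so $\alpha_{\mathcal N_i}^{1/2}$ is block diagonal with blocks $\alpha_j^{1/2}I_{n_j}$,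 $j\in\mathcal N_i$. $Z_{ij}=W_{\mathcal N_i}U_j^\top Z_jU_jW_{\mathcal N_i}^\top$, so that $x_{\mathcal N_i}^\top Z_{ij}x_{\mathcal N_i}=x_j^\top Z_jx_j$ for $j\in\mathcal N_i$. $\succeq 0$ means symmetric positive semidefinite. *)

theory Defs
  imports
    Complex_Main
    "Jordan_Normal_Form.Matrix"
    "Jordan_Normal_Form.Gauss_Jordan_Elimination"
begin

text \<open>
  Subsystems are indexed by \<open>{1..M}\<close> and \<open>n j\<close> is the state dimension of subsystem \<open>j\<close>.
  Vectors indexed by a set of subsystems are concatenated in increasing order of the index.
\<close>

definition psd :: "real mat \<Rightarrow> bool" where
  "psd A \<longleftrightarrow> A\<^sup>T = A \<and> (\<forall>v \<in> carrier_vec (dim_row A). v \<bullet> (A *\<^sub>v v) \<ge> 0)"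

definition pos_def :: "real mat \<Rightarrow> bool" where
  "pos_def A \<longleftrightarrow> A\<^sup>T = A \<and>
     (\<forall>v \<in> carrier_vec (dim_row A). v \<noteq> 0\<^sub>v (dim_row A) \<longrightarrow> v \<bullet> (A *\<^sub>v v) > 0)"

text \<open>The principal square root of a positive semidefinite matrix.\<close>

definition mat_sqrt :: "real mat \<Rightarrow> real mat" where
  "mat_sqrt A = (THE S. S \<in> carrier_mat (dim_row A) (dim_row A) \<and> psd S \<and> S * S = A)"

definition mat_sum :: "nat \<Rightarrow> nat \<Rightarrow> ('a \<Rightarrow> real mat) \<Rightarrow> 'a set \<Rightarrow> real mat" where
  "mat_sum nr nc F S = mat nr nc (\<lambda>(r, c). \<Sum>j\<in>S. F j $$ (r, c))"

definition concat_states :: "(nat \<Rightarrow> real vec) \<Rightarrow> nat set \<Rightarrow> real vec" where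
  "concat_states x S = foldr (\<lambda>j v. x j @\<^sub>v v) (sorted_list_of_set S) (0\<^sub>v 0)"

text \<open>The selection matrices \<open>U\<^sub>j\<close> and \<open>W\<^sub>S\<close>: for \<open>x = concat_states \<xi> {1..M}\<close>, one has
  \<open>U\<^sub>j x = \<xi> j\<close> and \<open>W\<^sub>S x = concat_states \<xi> S\<close>.\<close>

definition sel_U :: "nat \<Rightarrow> (nat \<Rightarrow> nat) \<Rightarrow> nat \<Rightarrow> real mat" where
  "sel_U M n j = mat (n j) (\<Sum>k=1..M. n k)
     (\<lambda>(r, c). if c = (\<Sum>k=1..<j. n k) + r then 1 else 0)"

definition sel_W :: "nat \<Rightarrow> (nat \<Rightarrow> nat) \<Rightarrow> nat set \<Rightarrow> real mat" where
  "sel_W M n S =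
     foldr (\<lambda>j A. sel_U M n j @\<^sub>r A) (sorted_list_of_set S) (0\<^sub>m 0 (\<Sum>k=1..M. n k))"

definition alpha_mat :: "nat \<Rightarrow> (nat \<Rightarrow> nat) \<Rightarrow> (nat \<Rightarrow> real) \<Rightarrow> real mat" where
  "alpha_mat M n \<alpha> = diag_block_mat (map (\<lambda>j. \<alpha> j \<cdot>\<^sub>m 1\<^sub>m (n j)) [1..<Suc M])"

definition alpha_nbr :: "nat \<Rightarrow> (nat \<Rightarrow> nat) \<Rightarrow> (nat \<Rightarrow> real) \<Rightarrow> nat set \<Rightarrow> real mat" where
  "alpha_nbr M n \<alpha> S = sel_W M n S * alpha_mat M n \<alpha> * (sel_W M n S)\<^sup>T"

definition Z_nbr :: "nat \<Rightarrow> (nat \<Rightarrow> nat) \<Rightarrow> (nat \<Rightarrow> real mat) \<Rightarrow> nat set \<Rightarrow> nat \<Rightarrow> real mat" where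
  "Z_nbr M n Z S j =
     sel_W M n S * (sel_U M n j)\<^sup>T * Z j * sel_U M n j * (sel_W M n S)\<^sup>T"

definition terminal_set :: "nat \<Rightarrow> real mat \<Rightarrow> real \<Rightarrow> real vec set" where
  "terminal_set d Z a = {x \<in> carrier_vec d. x \<bullet> (Z *\<^sub>v x) \<le> a}"

definition terminal_set_nbr ::
  "(nat \<Rightarrow> nat) \<Rightarrow> (nat \<Rightarrow> real mat) \<Rightarrow> (nat \<Rightarrow> real) \<Rightarrow> nat set \<Rightarrow> real vec set" where
  "terminal_set_nbr n Z \<alpha> S =
     {concat_states x S | x. \<forall>j\<in>S. x j \<in> terminal_set (n j) (Z j) (\<alpha> j)}"

end

theory Submission
  imports Defs "Jordan_Normal_Form.Determinant"
begin

text \<open>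
  Write \<open>x\<close> in the product of the terminal sets as \<open>R y\<close> with \<open>R = \<alpha>\<^sub>N\<^sup>1\<^sup>/\<^sup>2\<close>, so the blocks of \<open>y\<close>
  satisfy \<open>y\<^sub>j \<bullet> Z\<^sub>j y\<^sub>j \<le> 1\<close>, and put \<open>z = (A + B K) x = C y\<close>, \<open>q = z \<bullet> Z\<^sub>i z\<close>, \<open>a = sqrt \<alpha>\<^sub>i\<close>.
  The quadratic form of the block matrix at the stacked vector of \<open>Z\<^sub>i z\<close> and \<open>- a y\<close> is at most
  \<open>a q - 2 a q + a\<^sup>2 (\<Sum>j. l\<^sub>j) \<le> a (a\<^sup>2 - q)\<close>. As it is nonnegative, \<open>q \<le> a\<^sup>2 = \<alpha>\<^sub>i\<close>.
\<close>

section \<open>Stacked vectors and selection matrices\<close>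

text \<open>Keeps the lower bound \<open>1\<close> of the index intervals from being rewritten to
  \<open>Suc 0\<close>, so that sums over \<open>{1..M}\<close> and \<open>{1..<k}\<close> stay in
  matching form.\<close>

declare One_nat_def [simp del]

text \<open>Recursion over an arbitrary list replaces the \<open>foldr\<close> over
  \<open>sorted_list_of_set\<close>: the tail of such a list is again covered, so induction goes
  through without mentioning sets or sortedness.\<close>

primrec stack :: "(nat \<Rightarrow> real vec) \<Rightarrow> nat list \<Rightarrow> real vec" where
  "stack x [] = 0\<^sub>v 0"
| "stack x (k # l) = x k @\<^sub>v stack x l"

primrec stack_U :: "nat \<Rightarrow> (nat \<Rightarrow> nat) \<Rightarrow> nat list \<Rightarrow> real mat" where
  "stack_U M n [] = 0\<^sub>m 0 (\<Sum>k=1..M. n k)"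
| "stack_U M n (k # l) = sel_U M n k @\<^sub>r stack_U M n l"

lemma concat_states_eq_stack: "concat_states x S = stack x (sorted_list_of_set S)"
proof -
  have "foldr (\<lambda>j v. x j @\<^sub>v v) l (0\<^sub>v 0) = stack x l" for l by (induction l) auto
  then show ?thesis by (simp add: concat_states_def)
qed

lemma sel_W_eq_stack_U: "sel_W M n S = stack_U M n (sorted_list_of_set S)"
proof -
  have "foldr (\<lambda>j A. sel_U M n j @\<^sub>r A) l (0\<^sub>m 0 (\<Sum>k=1..M. n k)) = stack_U M n l" for l
    by (induction l) auto
  then show ?thesis by (simp add: sel_W_def)
qed

lemma stack_carrier:
  "(\<And>j. j \<in> set l \<Longrightarrow> x j \<in> carrier_vec (n j)) \<Longrightarrow> stack x l \<in> carrier_vec (sum_list (map n l))"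
  by (induction l) auto

lemma stack_cong: "(\<And>j. j \<in> set l \<Longrightarrow> x j = y j) \<Longrightarrow> stack x l = stack y l"
  by (induction l) auto

lemma smult_append_vec: "c \<cdot>\<^sub>v (v @\<^sub>v w) = (c \<cdot>\<^sub>v v) @\<^sub>v (c \<cdot>\<^sub>v w)"
  by (rule eq_vecI) auto

lemma zero_append_vec: "0\<^sub>v a @\<^sub>v 0\<^sub>v b = 0\<^sub>v (a + b)"
  by (rule eq_vecI) auto

lemma stack_smult: "stack (\<lambda>j. c \<cdot>\<^sub>v x j) l = c \<cdot>\<^sub>v stack x l"
  by (induction l) (auto simp: smult_append_vec)

lemma stack_zero: "stack (\<lambda>j. 0\<^sub>v (n j)) l = 0\<^sub>v (sum_list (map n l))"
  by (induction l) (auto simp: zero_append_vec)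

text \<open>A unit vector lives in a single block. This later shows that blockwise scaling
  multiplies each unit vector by one scalar, namely the one of its block \<open>k\<close>.\<close>

lemma unit_vec_stack:
  assumes "distinct l" "r < sum_list (map n l)"
  obtains k x where "k \<in> set l" "\<And>j. x j \<in> carrier_vec (n j)" "\<And>j. j \<noteq> k \<Longrightarrow> x j = 0\<^sub>v (n j)"
    "unit_vec (sum_list (map n l)) r = stack x l"
proof -
  have "\<exists>k x. k \<in> set l \<and> (\<forall>j. x j \<in> carrier_vec (n j)) \<and> (\<forall>j. j \<noteq> k \<longrightarrow> x j = 0\<^sub>v (n j))
      \<and> unit_vec (sum_list (map n l)) r = stack x l"
    using assms
  proof (induction l arbitrary: r)
    case Nil
    then show ?case by simp
  next
    case (Cons a l)
    let ?d = "sum_list (map n l)"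
    show ?case
    proof (cases "r < n a")
      case True
      define x where "x = (\<lambda>j. 0\<^sub>v (n j) :: real vec)(a := unit_vec (n a) r)"
      have "stack x l = stack (\<lambda>j. 0\<^sub>v (n j)) l"
        using Cons.prems by (intro stack_cong) (auto simp: x_def)
      moreover have "x a = unit_vec (n a) r" by (simp add: x_def)
      ultimately have "unit_vec (n a + ?d) r = stack x (a # l)"
        using True by (intro eq_vecI) (auto simp: stack_zero unit_vec_def)
      moreover have "x j \<in> carrier_vec (n j)" "j \<noteq> a \<Longrightarrow> x j = 0\<^sub>v (n j)" for j
        by (simp_all add: x_def)
      ultimately show ?thesis by auto
    next
      case False
      then have "r - n a < ?d" using Cons.prems by simp
      with Cons obtain k x where x: "k \<in> set l" "\<forall>j. x j \<in> carrier_vec (n j)"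
        "\<forall>j. j \<noteq> k \<longrightarrow> x j = 0\<^sub>v (n j)" "unit_vec ?d (r - n a) = stack x l" by force
      \<comment> \<open>Distinctness of the list gives \<open>a\<close> different from
        \<open>k\<close>, so the head block is a zero block.\<close>
      have "x a = 0\<^sub>v (n a)" using x(1,3) Cons.prems by auto
      then have "unit_vec (n a + ?d) r = stack x (a # l)"
        using False Cons.prems by (intro eq_vecI) (auto simp flip: x(4))
      then show ?thesis using x
        by (intro exI[of _ k] exI[of _ x]) auto
    qed
  qed
  then show ?thesis using that by blast
qed

section \<open>Blocks as disjoint intervals of global indices\<close>

lemma block_offset_mono:
  fixes n :: "nat \<Rightarrow> nat"
  assumes "1 \<le> j" "j < k"
  shows "(\<Sum>i=1..<j. n i) + n j \<le> (\<Sum>i=1..<k. n i)"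
proof -
  have "(\<Sum>i=1..<j. n i) + n j = (\<Sum>i=1..<Suc j. n i)" using assms by simp
  also have "\<dots> \<le> (\<Sum>i=1..<k. n i)" using assms by (intro sum_mono2) auto
  finally show ?thesis .
qed

lemma block_offset_le:
  fixes n :: "nat \<Rightarrow> nat"
  assumes "j \<in> {1..M}"
  shows "(\<Sum>i=1..<j. n i) + n j \<le> (\<Sum>i=1..M. n i)"
  using block_offset_mono[of j "Suc M" n] assms by (simp add: atLeastLessThanSuc_atLeastAtMost)

text \<open>Turns a global row index into the offset form in which the rows of
  \<open>alpha_mat\<close> are computed.\<close>

lemma block_index:
  fixes n :: "nat \<Rightarrow> nat"
  assumes "c < (\<Sum>i=1..M. n i)"
  obtains k r where "k \<in> {1..M}" "r < n k" "c = (\<Sum>i=1..<k. n i) + r"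
proof -
  have "\<exists>k r. k \<in> {1..M} \<and> r < n k \<and> c = (\<Sum>i=1..<k. n i) + r"
    using assms
  proof (induction M)
    case (Suc M)
    show ?case
    proof (cases "c < (\<Sum>i=1..M. n i)")
      case True
      then show ?thesis using Suc.IH by fastforce
    next
      case False
      then show ?thesis using Suc.prems
        by (intro exI[of _ "Suc M"] exI[of _ "c - (\<Sum>i=1..M. n i)"])
          (auto simp: atLeastLessThanSuc_atLeastAtMost)
    qed
  qed simp
  then show ?thesis using that by blast
qed

section \<open>Selection matrices and their transposes acting on vectors\<close>

lemma sel_U_carrier: "sel_U M n j \<in> carrier_mat (n j) (\<Sum>k=1..M. n k)"
  by (simp add: sel_U_def)

lemma sel_U_mult_vec:
  assumes "j \<in> {1..M}" "x \<in> carrier_vec (\<Sum>k=1..M. n k)"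
  shows "sel_U M n j *\<^sub>v x = vec (n j) (\<lambda>r. x $ ((\<Sum>k=1..<j. n k) + r))"
proof (rule eq_vecI)
  fix r assume "r < dim_vec (vec (n j) (\<lambda>r. x $ ((\<Sum>k=1..<j. n k) + r)))"
  then have r: "r < n j" by simp
  then have "(\<Sum>k=1..<j. n k) + r < (\<Sum>k=1..M. n k)" using block_offset_le[OF assms(1), of n] by simp
  moreover have "row (sel_U M n j) r = unit_vec (\<Sum>k=1..M. n k) ((\<Sum>k=1..<j. n k) + r)"
    using r by (intro eq_vecI) (auto simp: sel_U_def unit_vec_def)
  ultimately show "(sel_U M n j *\<^sub>v x) $ r = vec (n j) (\<lambda>r. x $ ((\<Sum>k=1..<j. n k) + r)) $ r"
    using r assms(2) by (simp add: sel_U_def)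
qed (simp add: sel_U_def)

lemma sel_U_transpose_mult_vec:
  assumes "v \<in> carrier_vec (n j)"
  shows "(sel_U M n j)\<^sup>T *\<^sub>v v = vec (\<Sum>k=1..M. n k)
    (\<lambda>c. if c \<in> {(\<Sum>k=1..<j. n k)..<(\<Sum>k=1..<j. n k) + n j} then v $ (c - (\<Sum>k=1..<j. n k)) else 0)"
    (is "_ = vec ?N ?f")
proof (rule eq_vecI)
  let ?o = "\<Sum>k=1..<j. n k"
  fix c assume "c < dim_vec (vec ?N ?f)"
  then have c: "c < ?N" by simp
  have "((sel_U M n j)\<^sup>T *\<^sub>v v) $ c = (\<Sum>r=0..<n j. (if c = ?o + r then 1 else 0) * v $ r)"
    using c assms by (auto simp: sel_U_def scalar_prod_def intro!: sum.cong)
  \<comment> \<open>Subtraction on naturals is truncated: for \<open>c < ?o\<close> the difference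
    is 0 and would wrongly match \<open>r = 0\<close>. The inner guard \<open>?o \<le> c\<close>
    excludes this case.\<close>
  also have "\<dots> = (\<Sum>r=0..<n j. if r = c - ?o then (if ?o \<le> c then v $ r else 0) else 0)"
    by (rule sum.cong) auto
  also have "\<dots> = ?f c"
    by (subst sum.delta) auto
  finally show "((sel_U M n j)\<^sup>T *\<^sub>v v) $ c = vec ?N ?f $ c" using c by simp
qed (simp add: sel_U_def)

text \<open>The orthogonality relation behind all later computations: the transpose places
  \<open>v\<close> in block \<open>k\<close> and zeros elsewhere, and the interval read for
  \<open>j \<noteq> k\<close> is disjoint from that block.\<close>

lemma sel_U_transpose_sel_U:
  assumes "j \<in> {1..M}" "k \<in> {1..M}" "v \<in> carrier_vec (n k)"
  shows "sel_U M n j *\<^sub>v ((sel_U M n k)\<^sup>T *\<^sub>v v) = (if j = k then v else 0\<^sub>v (n j))"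
proof -
  have c: "(sel_U M n k)\<^sup>T *\<^sub>v v \<in> carrier_vec (\<Sum>k=1..M. n k)"
    using sel_U_carrier[of M n k] by (intro carrier_vecI) simp
  have "vec (n j) (\<lambda>r. ((sel_U M n k)\<^sup>T *\<^sub>v v) $ ((\<Sum>i=1..<j. n i) + r))
      = (if j = k then v else 0\<^sub>v (n j))" (is "?l = ?r")
  proof (rule eq_vecI)
    show dim: "dim_vec ?l = dim_vec ?r" using assms(3) by simp
    fix r assume "r < dim_vec ?r"
    then have r: "r < n j" using dim by simp
    define c where "c = (\<Sum>i=1..<j. n i) + r"
    have "c < (\<Sum>i=1..M. n i)" using block_offset_le[OF assms(1), of n] r by (simp add: c_def)
    then have x: "?l $ r = (if c \<in> {(\<Sum>i=1..<k. n i)..<(\<Sum>i=1..<k. n i) + n k}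
        then v $ (c - (\<Sum>i=1..<k. n i)) else 0)"
      using r unfolding sel_U_transpose_mult_vec[of v n k M, OF assms(3)] c_def[symmetric]
      by (simp add: c_def)
    show "?l $ r = ?r $ r"
    proof (cases "j = k")
      case True
      then show ?thesis unfolding x using r by (simp add: c_def)
    next
      case False
      then have "c \<notin> {(\<Sum>i=1..<k. n i)..<(\<Sum>i=1..<k. n i) + n k}"
        using r block_offset_mono[of j k n] block_offset_mono[of k j n] assms(1,2)
        by (cases "j < k") (auto simp: c_def)
      then show ?thesis unfolding x using r False by (simp del: atLeastLessThan_iff)
    qed
  qed
  then show ?thesis unfolding sel_U_mult_vec[OF assms(1) c] .
qed

lemma stack_U_carrier:
  "stack_U M n l \<in> carrier_mat (sum_list (map n l)) (\<Sum>k=1..M. n k)"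
  by (induction l) (auto intro!: carrier_append_rows sel_U_carrier)

lemma transpose_append_rows_mult_vec:
  assumes "A \<in> carrier_mat a c" "B \<in> carrier_mat b c" "v \<in> carrier_vec a" "w \<in> carrier_vec b"
  shows "(A @\<^sub>r B)\<^sup>T *\<^sub>v (v @\<^sub>v w) = A\<^sup>T *\<^sub>v v + (B\<^sup>T *\<^sub>v w :: real vec)"
proof (rule eq_vecI)
  have AB: "A @\<^sub>r B \<in> carrier_mat (a + b) c" using assms by auto
  fix i assume "i < dim_vec (A\<^sup>T *\<^sub>v v + B\<^sup>T *\<^sub>v w)"
  then have i: "i < c" using assms by auto
  have "col (A @\<^sub>r B) i = col A i @\<^sub>v col B i"
    using assms i AB by (intro eq_vecI) (auto simp: append_rows_def)
  then show "((A @\<^sub>r B)\<^sup>T *\<^sub>v (v @\<^sub>v w)) $ i = (A\<^sup>T *\<^sub>v v + B\<^sup>T *\<^sub>v w) $ i"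
    using i assms AB scalar_prod_append[of "col A i" a "col B i" b v w]
    by (simp add: carrier_matD[OF AB])
qed (use assms in \<open>auto simp: append_rows_def\<close>)

lemma stack_U_mult_vec:
  assumes "x \<in> carrier_vec (\<Sum>k=1..M. n k)"
  shows "stack_U M n l *\<^sub>v x = stack (\<lambda>j. sel_U M n j *\<^sub>v x) l"
proof (induction l)
  case Nil
  then show ?case by (intro eq_vecI) auto
next
  case (Cons k l)
  then show ?case
    using mat_mult_append[OF sel_U_carrier stack_U_carrier assms] by simp
qed

lemma stack_U_transpose_Cons:
  assumes "\<And>j. j \<in> set (k # l) \<Longrightarrow> x j \<in> carrier_vec (n j)"
  shows "(stack_U M n (k # l))\<^sup>T *\<^sub>v stack x (k # l)
    = (sel_U M n k)\<^sup>T *\<^sub>v x k + (stack_U M n l)\<^sup>T *\<^sub>v stack x l"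
  using assms transpose_append_rows_mult_vec[OF sel_U_carrier stack_U_carrier, of "x k" n k "stack x l" l M]
    stack_carrier[of l x n] by simp

lemma stack_U_transpose_carrier:
  "(stack_U M n l)\<^sup>T *\<^sub>v v \<in> carrier_vec (\<Sum>k=1..M. n k)"
  using stack_U_carrier[of M n l] by (intro carrier_vecI) simp

lemma sel_U_transpose_carrier: "(sel_U M n k)\<^sup>T *\<^sub>v v \<in> carrier_vec (\<Sum>k=1..M. n k)"
  using sel_U_carrier[of M n k] by (intro carrier_vecI) simp

text \<open>The transposed stack adds up the embedded blocks, and orthogonality leaves only the
  summand of block \<open>j\<close>. Distinctness ensures that no block is added twice.\<close>

lemma sel_U_stack_U_transpose:
  assumes "distinct l" "set l \<subseteq> {1..M}" "j \<in> {1..M}"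
    and "\<And>j. j \<in> set l \<Longrightarrow> x j \<in> carrier_vec (n j)"
  shows "sel_U M n j *\<^sub>v ((stack_U M n l)\<^sup>T *\<^sub>v stack x l) = (if j \<in> set l then x j else 0\<^sub>v (n j))"
  using assms
proof (induction l)
  case Nil
  then show ?case
    by (intro eq_vecI) (auto simp: sel_U_def scalar_prod_def)
next
  case (Cons k l)
  have "sel_U M n j *\<^sub>v ((stack_U M n (k # l))\<^sup>T *\<^sub>v stack x (k # l))
      = sel_U M n j *\<^sub>v ((sel_U M n k)\<^sup>T *\<^sub>v x k) + sel_U M n j *\<^sub>v ((stack_U M n l)\<^sup>T *\<^sub>v stack x l)"
    using stack_U_transpose_Cons[of k l x n M] Cons.prems
      mult_add_distrib_mat_vec[OF sel_U_carrier sel_U_transpose_carrier stack_U_transpose_carrier]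
    by simp
  also have "\<dots> = (if j = k then x k else 0\<^sub>v (n j)) + (if j \<in> set l then x j else 0\<^sub>v (n j))"
    using Cons sel_U_transpose_sel_U[of j M k "x k" n] by auto
  finally show ?case using Cons.prems by auto
qed

text \<open>The identity \<open>W W\<^sup>T = I\<close>, evaluated on stacks: reading back each
  embedded block returns it unchanged.\<close>

lemma stack_U_stack_U_transpose:
  assumes "distinct l" "set l \<subseteq> {1..M}" "\<And>j. j \<in> set l \<Longrightarrow> x j \<in> carrier_vec (n j)"
  shows "stack_U M n l *\<^sub>v ((stack_U M n l)\<^sup>T *\<^sub>v stack x l) = stack x l"
  unfolding stack_U_mult_vec[OF stack_U_transpose_carrier]
  using sel_U_stack_U_transpose[OF assms(1,2) _ assms(3)] assms(2) by (intro stack_cong) auto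

section \<open>The scaling matrix and its square root\<close>

lemma alpha_mat_carrier: "alpha_mat M n \<alpha> \<in> carrier_mat (\<Sum>k=1..M. n k) (\<Sum>k=1..M. n k)"
proof -
  have "sum_list (map n [1..<Suc M]) = (\<Sum>k=1..M. n k)"
    by (subst sum_set_upt_conv_sum_list_nat[symmetric])
      (simp only: atLeastLessThanSuc_atLeastAtMost set_upt)
  then show ?thesis
    by (intro carrier_matI) (simp_all add: alpha_mat_def dim_diag_block_mat comp_def del: upt_Suc)
qed

text \<open>The prefix \<open>xs\<close> fixes the row offset, and induction peels off its blocks
  one at a time. The column \<open>c\<close> is generalized because each peeled block shifts
  it.\<close>

lemma diag_block_mat_scalar_index:
  assumes "r < n j" "c < sum_list (map n (xs @ j # ys))"
  shows "diag_block_mat (map (\<lambda>j. \<alpha> j \<cdot>\<^sub>m 1\<^sub>m (n j)) (xs @ j # ys)) $$ (sum_list (map n xs) + r, c)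
    = (if c = sum_list (map n xs) + r then \<alpha> j else (0 :: real))"
  using assms
proof (induction xs arbitrary: c)
  case Nil
  then show ?case by (auto simp: Let_def dim_diag_block_mat comp_def)
next
  case (Cons x xs)
  \<comment> \<open>The row lies below the leading block, so columns \<open>c < n x\<close> meet a
    zero block. Only the remaining columns, shifted by \<open>n x\<close>, need the induction
    hypothesis.\<close>
  have "diag_block_mat (map (\<lambda>j. \<alpha> j \<cdot>\<^sub>m 1\<^sub>m (n j)) (xs @ j # ys)) $$ (sum_list (map n xs) + r, c - n x)
    = (if c - n x = sum_list (map n xs) + r then \<alpha> j else (0 :: real))" if "\<not> c < n x"
    using that Cons by (intro Cons.IH) auto
  then show ?case using Cons.prems
    by (auto simp: Let_def dim_diag_block_mat comp_def)
qed

lemma row_alpha_mat: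
  assumes "k \<in> {1..M}" "r < n k"
  shows "row (alpha_mat M n \<alpha>) ((\<Sum>i=1..<k. n i) + r)
    = \<alpha> k \<cdot>\<^sub>v unit_vec (\<Sum>i=1..M. n i) ((\<Sum>i=1..<k. n i) + r)"
proof (rule eq_vecI)
  let ?o = "\<Sum>i=1..<k. n i"
  have b: "?o + r < (\<Sum>i=1..M. n i)" using block_offset_le[OF assms(1), of n] assms(2) by simp
  have split: "[1..<Suc M] = [1..<k] @ k # [Suc k..<Suc M]"
    using assms(1) upt_add_eq_append[of 1 k "Suc M - k"] upt_conv_Cons[of k "Suc M"] by simp
  have o: "sum_list (map n [1..<k]) = ?o"
    by (subst sum_set_upt_conv_sum_list_nat[symmetric]) simp
  have t: "sum_list (map n [1..<Suc M]) = (\<Sum>k=1..M. n k)"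
    by (subst sum_set_upt_conv_sum_list_nat[symmetric])
      (simp only: atLeastLessThanSuc_atLeastAtMost set_upt)
  fix c assume "c < dim_vec (\<alpha> k \<cdot>\<^sub>v unit_vec (\<Sum>i=1..M. n i) (?o + r))"
  then have c: "c < (\<Sum>i=1..M. n i)" by simp
  have "alpha_mat M n \<alpha> $$ (?o + r, c) = (if c = ?o + r then \<alpha> k else 0)"
    using diag_block_mat_scalar_index[of r n k c "[1..<k]" "[Suc k..<Suc M]" \<alpha>] assms(2) c
    unfolding split[symmetric] o t alpha_mat_def by blast
  then show "row (alpha_mat M n \<alpha>) (?o + r) $ c = (\<alpha> k \<cdot>\<^sub>v unit_vec (\<Sum>i=1..M. n i) (?o + r)) $ c"
    using b c alpha_mat_carrier[of M n \<alpha>] by auto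
qed (use alpha_mat_carrier[of M n \<alpha>] in auto)

text \<open>On block \<open>k\<close> the matrix is the scalar \<open>\<alpha> k\<close>, so scaling
  may be done before embedding. Row \<open>c\<close> in block \<open>j\<close> contributes the
  factor \<open>\<alpha> j\<close>, but for \<open>j \<noteq> k\<close> the embedded vector vanishes
  there.\<close>

lemma alpha_mat_sel_U_transpose:
  assumes "k \<in> {1..M}" "v \<in> carrier_vec (n k)"
  shows "alpha_mat M n \<alpha> *\<^sub>v ((sel_U M n k)\<^sup>T *\<^sub>v v) = (sel_U M n k)\<^sup>T *\<^sub>v (\<alpha> k \<cdot>\<^sub>v v)"
proof (rule eq_vecI)
  let ?x = "(sel_U M n k)\<^sup>T *\<^sub>v v" and ?N = "\<Sum>i=1..M. n i"
  fix c assume "c < dim_vec ((sel_U M n k)\<^sup>T *\<^sub>v (\<alpha> k \<cdot>\<^sub>v v))"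
  then have c: "c < ?N" using sel_U_carrier[of M n k] by auto
  then obtain j r where jr: "j \<in> {1..M}" "r < n j" "c = (\<Sum>i=1..<j. n i) + r"
    using block_index by blast
  have "(alpha_mat M n \<alpha> *\<^sub>v ?x) $ c = (\<alpha> j \<cdot>\<^sub>v unit_vec ?N c) \<bullet> ?x"
    using c alpha_mat_carrier[of M n \<alpha>] row_alpha_mat[of j M r n \<alpha>] jr by simp
  also have "\<dots> = \<alpha> j * ?x $ c"
    using c sel_U_transpose_carrier[of M n k v] by (simp add: smult_scalar_prod_distrib[of _ ?N])
  also have "\<dots> = ((sel_U M n k)\<^sup>T *\<^sub>v (\<alpha> k \<cdot>\<^sub>v v)) $ c"
  proof (cases "j = k")
    case True
    then show ?thesis using c assms(2) jr
      by (simp add: sel_U_transpose_mult_vec)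
  next
    case False
    then have "c \<notin> {(\<Sum>i=1..<k. n i)..<(\<Sum>i=1..<k. n i) + n k}"
      using jr block_offset_mono[of j k n] block_offset_mono[of k j n] assms(1)
      by (cases "j < k") auto
    then show ?thesis using c assms(2)
      by (simp add: sel_U_transpose_mult_vec del: atLeastLessThan_iff)
  qed
  finally show "(alpha_mat M n \<alpha> *\<^sub>v ?x) $ c = ((sel_U M n k)\<^sup>T *\<^sub>v (\<alpha> k \<cdot>\<^sub>v v)) $ c" .
qed (use alpha_mat_carrier[of M n \<alpha>] sel_U_carrier[of M n k] in auto)

lemma alpha_mat_stack_U_transpose:
  assumes "set l \<subseteq> {1..M}" "\<And>j. j \<in> set l \<Longrightarrow> x j \<in> carrier_vec (n j)"
  shows "alpha_mat M n \<alpha> *\<^sub>v ((stack_U M n l)\<^sup>T *\<^sub>v stack x l)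
    = (stack_U M n l)\<^sup>T *\<^sub>v stack (\<lambda>j. \<alpha> j \<cdot>\<^sub>v x j) l"
  using assms
proof (induction l)
  case Nil
  then show ?case using alpha_mat_carrier[of M n \<alpha>]
    by (intro eq_vecI) (auto simp: scalar_prod_def)
next
  case (Cons k l)
  have "alpha_mat M n \<alpha> *\<^sub>v ((stack_U M n (k # l))\<^sup>T *\<^sub>v stack x (k # l))
      = alpha_mat M n \<alpha> *\<^sub>v ((sel_U M n k)\<^sup>T *\<^sub>v x k)
        + alpha_mat M n \<alpha> *\<^sub>v ((stack_U M n l)\<^sup>T *\<^sub>v stack x l)"
    by (subst stack_U_transpose_Cons, erule Cons.prems(2),
        rule mult_add_distrib_mat_vec[OF alpha_mat_carrier sel_U_transpose_carrier stack_U_transpose_carrier])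
  also have "\<dots> = (sel_U M n k)\<^sup>T *\<^sub>v (\<alpha> k \<cdot>\<^sub>v x k) + (stack_U M n l)\<^sup>T *\<^sub>v stack (\<lambda>j. \<alpha> j \<cdot>\<^sub>v x j) l"
    using Cons alpha_mat_sel_U_transpose[of k M "x k" n \<alpha>] by simp
  also have "\<dots> = (stack_U M n (k # l))\<^sup>T *\<^sub>v stack (\<lambda>j. \<alpha> j \<cdot>\<^sub>v x j) (k # l)"
    using stack_U_transpose_Cons[of k l "\<lambda>j. \<alpha> j \<cdot>\<^sub>v x j" n M] Cons.prems by simp
  finally show ?case .
qed

section \<open>The scaling matrix restricted to a neighborhood\<close>

lemma sel_W_carrier:
  assumes "finite S"
  shows "sel_W M n S \<in> carrier_mat (\<Sum>j\<in>S. n j) (\<Sum>k=1..M. n k)"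
proof -
  have "sum_list (map n (sorted_list_of_set S)) = (\<Sum>j\<in>S. n j)"
    using assms by (simp add: sum_list_distinct_conv_sum_set)
  then show ?thesis
    using stack_U_carrier[of M n "sorted_list_of_set S"] by (simp add: sel_W_eq_stack_U)
qed

lemma concat_states_carrier:
  assumes "finite S" "\<And>j. j \<in> S \<Longrightarrow> x j \<in> carrier_vec (n j)"
  shows "concat_states x S \<in> carrier_vec (\<Sum>j\<in>S. n j)"
  using stack_carrier[of "sorted_list_of_set S" x n] assms
  by (simp add: concat_states_eq_stack sum_list_distinct_conv_sum_set)

lemma alpha_nbr_carrier:
  "finite S \<Longrightarrow> alpha_nbr M n \<alpha> S \<in> carrier_mat (\<Sum>j\<in>S. n j) (\<Sum>j\<in>S. n j)"
  using sel_W_carrier[of S M n] alpha_mat_carrier[of M n \<alpha>] by (simp add: alpha_nbr_def)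

text \<open>The diagonal scaling is moved past \<open>W\<^sup>T\<close>, where it becomes blockwise
  scaling of the states; then \<open>W W\<^sup>T = I\<close> removes the selection matrices.\<close>

lemma alpha_nbr_concat_states:
  assumes "S \<subseteq> {1..M}" "\<And>j. j \<in> S \<Longrightarrow> x j \<in> carrier_vec (n j)"
  shows "alpha_nbr M n \<alpha> S *\<^sub>v concat_states x S = concat_states (\<lambda>j. \<alpha> j \<cdot>\<^sub>v x j) S"
proof -
  have fin: "finite S" using assms(1) finite_subset by blast
  note W = sel_W_carrier[OF fin, of M n] and a = alpha_mat_carrier[of M n \<alpha>]
    and x = concat_states_carrier[OF fin, of x n, OF assms(2)]
  have "alpha_nbr M n \<alpha> S *\<^sub>v concat_states x S
    = sel_W M n S *\<^sub>v (alpha_mat M n \<alpha> *\<^sub>v ((sel_W M n S)\<^sup>T *\<^sub>v concat_states x S))"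
    unfolding alpha_nbr_def using W x
    by (simp add: assoc_mult_mat_vec[OF mult_carrier_mat[OF W a], of _ "\<Sum>j\<in>S. n j"]
        assoc_mult_mat_vec[OF W a] del: assoc_mult_mat)
  also have "\<dots> = concat_states (\<lambda>j. \<alpha> j \<cdot>\<^sub>v x j) S"
    unfolding sel_W_eq_stack_U concat_states_eq_stack using assms fin
    by (subst alpha_mat_stack_U_transpose[of _ _ _ n]) (auto intro!: stack_U_stack_U_transpose)
  finally show ?thesis .
qed

text \<open>The block \<open>k\<close> is chosen before \<open>\<alpha>\<close> is quantified, so
  the same \<open>k\<close> serves both for \<open>\<alpha>\<close> and for its square
  roots.\<close>

lemma alpha_nbr_unit_vec:
  assumes "S \<subseteq> {1..M}" "r < (\<Sum>j\<in>S. n j)"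
  obtains k where "k \<in> S"
    "\<And>\<alpha>. alpha_nbr M n \<alpha> S *\<^sub>v unit_vec (\<Sum>j\<in>S. n j) r = \<alpha> k \<cdot>\<^sub>v unit_vec (\<Sum>j\<in>S. n j) r"
proof -
  let ?l = "sorted_list_of_set S"
  have fin: "finite S" using assms(1) finite_subset by blast
  have d: "sum_list (map n ?l) = (\<Sum>j\<in>S. n j)"
    using fin by (simp add: sum_list_distinct_conv_sum_set)
  obtain k x where kx: "k \<in> S" "\<And>j. x j \<in> carrier_vec (n j)" "\<And>j. j \<noteq> k \<Longrightarrow> x j = 0\<^sub>v (n j)"
    "unit_vec (\<Sum>j\<in>S. n j) r = concat_states x S"
    using unit_vec_stack[of ?l r n] assms(2) fin unfolding d concat_states_eq_stack by auto
  have "alpha_nbr M n \<alpha> S *\<^sub>v concat_states x S = \<alpha> k \<cdot>\<^sub>v concat_states x S" for \<alpha>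
  proof -
    \<comment> \<open>Outside block \<open>k\<close> both sides are zero, so the blockwise factors
      may be replaced by the single factor \<open>\<alpha> k\<close>.\<close>
    have "\<alpha> j \<cdot>\<^sub>v x j = \<alpha> k \<cdot>\<^sub>v x j" for j
      using kx(3)[of j] by (cases "j = k") auto
    then show ?thesis
      unfolding alpha_nbr_concat_states[OF assms(1) kx(2)]
      by (simp add: concat_states_eq_stack stack_smult)
  qed
  with kx show ?thesis using that by simp
qed

section \<open>Identification of the principal square root\<close>

lemma mat_eq_unit_vecI:
  assumes "A \<in> carrier_mat d d" "B \<in> carrier_mat d d"
    and "\<And>r. r < d \<Longrightarrow> A *\<^sub>v unit_vec d r = B *\<^sub>v unit_vec d r"
  shows "A = (B :: real mat)"
proof (rule eq_matI)
  fix i j assume "i < dim_row B" "j < dim_col B"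
  then have ij: "i < d" "j < d" using assms by auto
  then have "(A *\<^sub>v unit_vec d j) $ i = (B *\<^sub>v unit_vec d j) $ i" using assms(3) by simp
  with ij assms(1,2) show "A $$ (i, j) = B $$ (i, j)"
    by (simp add: scalar_prod_right_unit[of _ d])
qed (use assms in auto)

lemma scalar_prod_self_eq_0:
  assumes "w \<in> carrier_vec d" "w \<bullet> w \<le> (0 :: real)"
  shows "w = 0\<^sub>v d"
proof (rule eq_vecI)
  have "0 \<le> (\<Sum>i\<in>{0..<d}. w $ i * w $ i)" by (intro sum_nonneg) simp
  moreover have "(\<Sum>i\<in>{0..<d}. w $ i * w $ i) \<le> 0"
    using assms by (simp add: scalar_prod_def)
  ultimately have "\<forall>i\<in>{0..<d}. w $ i * w $ i = 0"
    by (subst sum_nonneg_eq_0_iff[symmetric]) (auto intro: antisym)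
  then show "w $ i = 0\<^sub>v d $ i" if "i < dim_vec (0\<^sub>v d)" for i
    using that by simp
  show "dim_vec w = dim_vec (0\<^sub>v d)" using assms(1) by simp
qed

text \<open>The vector \<open>w = S v - t v\<close> satisfies \<open>S w = - t w\<close>, which forces \<open>w = 0\<close> as \<open>S\<close> is
  positive semidefinite.\<close>

lemma psd_sqrt_eigenvector:
  assumes S: "S \<in> carrier_mat d d" "psd S" and v: "v \<in> carrier_vec d" and t: "t > 0"
    and eq: "S *\<^sub>v (S *\<^sub>v v) = (t * t) \<cdot>\<^sub>v v"
  shows "S *\<^sub>v v = t \<cdot>\<^sub>v v"
proof -
  define w where "w = S *\<^sub>v v - t \<cdot>\<^sub>v v"
  have Sv: "S *\<^sub>v v \<in> carrier_vec d" using S v by simp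
  have w: "w \<in> carrier_vec d" using v Sv by (simp add: w_def)
  have "S *\<^sub>v w = S *\<^sub>v (S *\<^sub>v v) - t \<cdot>\<^sub>v (S *\<^sub>v v)"
    unfolding w_def using S v Sv by (simp add: mult_minus_distrib_mat_vec mult_mat_vec)
  also have "\<dots> = (- t) \<cdot>\<^sub>v w"
    unfolding eq w_def using carrier_vecD[OF v] carrier_vecD[OF Sv] S(1)
    by (intro eq_vecI) (auto simp: right_diff_distrib)
  finally have "w \<bullet> (S *\<^sub>v w) = - t * (w \<bullet> w)" using w by simp
  moreover have "0 \<le> w \<bullet> (S *\<^sub>v w)" using S w by (simp add: psd_def)
  ultimately have "w \<bullet> w \<le> 0" using t by (simp add: zero_le_mult_iff mult_le_0_iff)
  then have "w = 0\<^sub>v d" using w scalar_prod_self_eq_0 by blast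
  show ?thesis
  proof (rule eq_vecI)
    fix i assume "i < dim_vec (t \<cdot>\<^sub>v v)"
    then have "i < d" using v by simp
    moreover have "w $ i = 0\<^sub>v d $ i" using \<open>w = 0\<^sub>v d\<close> by simp
    ultimately show "(S *\<^sub>v v) $ i = (t \<cdot>\<^sub>v v) $ i" using v Sv by (simp add: w_def)
  qed (use v S in auto)
qed

text \<open>Since \<open>mat_sqrt\<close> is a definite description, both existence and uniqueness
  are needed. \<open>T\<close> is a positive semidefinite root of \<open>D\<close>; any other such
  root \<open>S\<close> agrees with \<open>T\<close> on every unit vector by
  \<open>psd_sqrt_eigenvector\<close>.\<close>

lemma mat_sqrt_eqI:
  assumes T: "T \<in> carrier_mat d d" and D: "D \<in> carrier_mat d d"
    and eig: "\<And>r. r < d \<Longrightarrow> \<exists>t>0. T *\<^sub>v unit_vec d r = t \<cdot>\<^sub>v unit_vec d r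
      \<and> D *\<^sub>v unit_vec d r = (t * t) \<cdot>\<^sub>v unit_vec d r"
  shows "mat_sqrt D = T"
proof -
  obtain t where t: "\<And>r. r < d \<Longrightarrow> t r > 0"
    "\<And>r. r < d \<Longrightarrow> T *\<^sub>v unit_vec d r = t r \<cdot>\<^sub>v unit_vec d r"
    "\<And>r. r < d \<Longrightarrow> D *\<^sub>v unit_vec d r = (t r * t r) \<cdot>\<^sub>v unit_vec d r"
    using eig by metis
  \<comment> \<open>All unit vectors being eigenvectors, \<open>T\<close> is diagonal with positive
    entries \<open>t r\<close>; symmetry and positive semidefiniteness are read off from
    this.\<close>
  have ent: "T $$ (i, r) = (if i = r then t r else 0)" if "i < d" "r < d" for i r
  proof -
    have "(T *\<^sub>v unit_vec d r) $ i = (t r \<cdot>\<^sub>v unit_vec d r) $ i" using t(2) that by simp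
    then show ?thesis using that T by (simp add: scalar_prod_right_unit[of _ d] split: if_splits)
  qed
  have "T *\<^sub>v v = vec d (\<lambda>i. t i * v $ i)" if "v \<in> carrier_vec d" for v
  proof (rule eq_vecI)
    fix i assume "i < dim_vec (vec d (\<lambda>i. t i * v $ i))"
    then have i: "i < d" by simp
    have "(T *\<^sub>v v) $ i = (\<Sum>r=0..<d. T $$ (i, r) * v $ r)"
      using i T that by (auto simp: scalar_prod_def)
    also have "\<dots> = (\<Sum>r=0..<d. if i = r then t r * v $ r else 0)"
      using i by (intro sum.cong) (auto simp: ent)
    finally show "(T *\<^sub>v v) $ i = vec d (\<lambda>i. t i * v $ i) $ i" using i by simp
  qed (use T in auto)
  then have "v \<bullet> (T *\<^sub>v v) \<ge> 0" if "v \<in> carrier_vec d" for v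
    using that t(1) by (auto simp: scalar_prod_def mult.left_commute intro!: sum_nonneg)
      (metis less_eq_real_def mult_nonneg_nonneg zero_le_square)
  moreover have "T\<^sup>T = T"
    using T by (intro eq_matI) (auto simp: ent)
  ultimately have psd: "psd T" using T by (simp add: psd_def)
  have TT: "T * T = D"
  proof (rule mat_eq_unit_vecI[OF _ D])
    fix r assume r: "r < d"
    then have "T *\<^sub>v (t r \<cdot>\<^sub>v unit_vec d r) = (t r * t r) \<cdot>\<^sub>v unit_vec d r"
      using mult_mat_vec[OF T] t(2) by (simp add: smult_smult_assoc)
    then show "T * T *\<^sub>v unit_vec d r = D *\<^sub>v unit_vec d r"
      using r t(2,3) T by simp
  qed (use T in simp)
  have uniq: "S = T" if S: "S \<in> carrier_mat d d" "psd S" "S * S = D" for S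
  proof (rule mat_eq_unit_vecI[OF S(1) T])
    fix r assume r: "r < d"
    have "S *\<^sub>v (S *\<^sub>v unit_vec d r) = (t r * t r) \<cdot>\<^sub>v unit_vec d r"
      using S t(3)[OF r] assoc_mult_mat_vec[OF S(1) S(1), of "unit_vec d r"] by simp
    then show "S *\<^sub>v unit_vec d r = T *\<^sub>v unit_vec d r"
      using psd_sqrt_eigenvector[OF S(1,2) _ t(1)[OF r]] t(2)[OF r] by simp
  qed
  show ?thesis
    unfolding mat_sqrt_def carrier_matD(1)[OF D]
    by (rule the_equality) (use T psd TT in blast, use uniq in blast)
qed

text \<open>Makes the abstract root explicit: on the unit vectors of block \<open>k\<close> the two
  matrices have eigenvalues \<open>\<alpha> k\<close> and \<open>sqrt (\<alpha> k)\<close>, the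
  latter positive as \<open>mat_sqrt_eqI\<close> demands.\<close>

lemma mat_sqrt_alpha_nbr:
  assumes "S \<subseteq> {1..M}" "\<And>j. j \<in> S \<Longrightarrow> \<alpha> j > 0"
  shows "mat_sqrt (alpha_nbr M n \<alpha> S) = alpha_nbr M n (\<lambda>j. sqrt (\<alpha> j)) S"
proof (rule mat_sqrt_eqI)
  have fin: "finite S" using assms(1) finite_subset by blast
  let ?d = "\<Sum>j\<in>S. n j"
  show "alpha_nbr M n (\<lambda>j. sqrt (\<alpha> j)) S \<in> carrier_mat ?d ?d" "alpha_nbr M n \<alpha> S \<in> carrier_mat ?d ?d"
    using fin by (rule alpha_nbr_carrier)+
  fix r assume r: "r < ?d"
  obtain k where k: "k \<in> S" "\<And>\<alpha>. alpha_nbr M n \<alpha> S *\<^sub>v unit_vec ?d r = \<alpha> k \<cdot>\<^sub>v unit_vec ?d r"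
    using alpha_nbr_unit_vec[OF assms(1) r] by blast
  show "\<exists>t>0. alpha_nbr M n (\<lambda>j. sqrt (\<alpha> j)) S *\<^sub>v unit_vec ?d r = t \<cdot>\<^sub>v unit_vec ?d r
      \<and> alpha_nbr M n \<alpha> S *\<^sub>v unit_vec ?d r = (t * t) \<cdot>\<^sub>v unit_vec ?d r"
    using k assms(2)[OF k(1)] by (intro exI[of _ "sqrt (\<alpha> k)"]) simp
qed

section \<open>Quadratic forms\<close>

lemma Z_nbr_carrier:
  assumes "finite S"
  shows "Z_nbr M n Z S j \<in> carrier_mat (\<Sum>j\<in>S. n j) (\<Sum>j\<in>S. n j)"
  using sel_W_carrier[OF assms, of M n] by (auto simp: Z_nbr_def)

text \<open>Moving \<open>W\<close> and then \<open>U\<^sup>T\<close> to the other side of the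
  scalar product, the form sees the stacked vector only through \<open>U W\<^sup>T\<close>, which
  extracts block \<open>j\<close>.\<close>

lemma Z_nbr_quadratic_form:
  assumes "S \<subseteq> {1..M}" "\<And>j. j \<in> S \<Longrightarrow> x j \<in> carrier_vec (n j)" "j \<in> S"
    and Z: "Z j \<in> carrier_mat (n j) (n j)"
  shows "concat_states x S \<bullet> (Z_nbr M n Z S j *\<^sub>v concat_states x S) = x j \<bullet> (Z j *\<^sub>v x j)"
proof -
  have fin: "finite S" using assms(1) finite_subset by blast
  let ?W = "sel_W M n S" and ?U = "sel_U M n j" and ?x = "concat_states x S"
  let ?N = "\<Sum>k=1..M. n k" and ?d = "\<Sum>j\<in>S. n j"
  have W: "?W \<in> carrier_mat ?d ?N" and WT: "?W\<^sup>T \<in> carrier_mat ?N ?d"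
    using sel_W_carrier[OF fin, of M n] by auto
  have U: "?U \<in> carrier_mat (n j) ?N" and UT: "?U\<^sup>T \<in> carrier_mat ?N (n j)"
    using sel_U_carrier[of M n j] by auto
  have x: "?x \<in> carrier_vec ?d" using concat_states_carrier[OF fin, of x n] assms(2) by simp
  have sel: "?U *\<^sub>v (?W\<^sup>T *\<^sub>v ?x) = x j"
    unfolding sel_W_eq_stack_U concat_states_eq_stack
    using sel_U_stack_U_transpose[of "sorted_list_of_set S" M j x n] assms fin by auto
  have xj: "x j \<in> carrier_vec (n j)" using assms by simp
  have Zx: "Z j *\<^sub>v x j \<in> carrier_vec (n j)" using Z xj by simp
  have "Z_nbr M n Z S j *\<^sub>v ?x = ?W *\<^sub>v (?U\<^sup>T *\<^sub>v (Z j *\<^sub>v (?U *\<^sub>v (?W\<^sup>T *\<^sub>v ?x))))"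
  proof -
    note c1 = mult_carrier_mat[OF W UT]
    note c2 = mult_carrier_mat[OF c1 Z]
    note c3 = mult_carrier_mat[OF c2 U]
    have y: "?W\<^sup>T *\<^sub>v ?x \<in> carrier_vec ?N" using WT x by simp
    have z: "?U *\<^sub>v (?W\<^sup>T *\<^sub>v ?x) \<in> carrier_vec (n j)" using U y by simp
    show ?thesis
      unfolding Z_nbr_def assoc_mult_mat_vec[OF c3 WT x] assoc_mult_mat_vec[OF c2 U y]
        assoc_mult_mat_vec[OF c1 Z z] by (rule assoc_mult_mat_vec[OF W UT mult_mat_vec_carrier[OF Z z]])
  qed
  then have "?x \<bullet> (Z_nbr M n Z S j *\<^sub>v ?x) = ?x \<bullet> (?W *\<^sub>v (?U\<^sup>T *\<^sub>v (Z j *\<^sub>v x j)))"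
    unfolding sel by simp
  also have "\<dots> = (?W\<^sup>T *\<^sub>v ?x) \<bullet> (?U\<^sup>T *\<^sub>v (Z j *\<^sub>v x j))"
    using UT Zx x by (intro transpose_vec_mult_scalar[OF W, symmetric]) auto
  also have "\<dots> = (?U\<^sup>T *\<^sub>v (Z j *\<^sub>v x j)) \<bullet> (?W\<^sup>T *\<^sub>v ?x)"
    using UT WT Zx x by (intro comm_scalar_prod[of _ ?N]) auto
  also have "\<dots> = (Z j *\<^sub>v x j) \<bullet> x j"
    using transpose_vec_mult_scalar[OF U _ Zx, of "?W\<^sup>T *\<^sub>v ?x"] WT x sel by simp
  also have "\<dots> = x j \<bullet> (Z j *\<^sub>v x j)" using Zx xj by (rule comm_scalar_prod)
  finally show ?thesis .
qed

text \<open>\<open>mat_sum\<close> is defined entrywise, so linearity is recovered by exchanging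
  finite sums twice: in the matrix-vector product and in the scalar product.\<close>

lemma mat_sum_quadratic_form:
  assumes "\<And>j. j \<in> S \<Longrightarrow> F j \<in> carrier_mat d d" "y \<in> carrier_vec d"
  shows "y \<bullet> (mat_sum d d F S *\<^sub>v y) = (\<Sum>j\<in>S. y \<bullet> (F j *\<^sub>v y))"
proof -
  have "(mat_sum d d F S *\<^sub>v y) $ r = (\<Sum>j\<in>S. (F j *\<^sub>v y) $ r)" if "r < d" for r
  proof -
    have "(mat_sum d d F S *\<^sub>v y) $ r = (\<Sum>c=0..<d. \<Sum>j\<in>S. F j $$ (r, c) * y $ c)"
      using that assms(2) by (simp add: mat_sum_def scalar_prod_def sum_distrib_right)
    also have "\<dots> = (\<Sum>j\<in>S. \<Sum>c=0..<d. F j $$ (r, c) * y $ c)" by (rule sum.swap)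
    also have "\<dots> = (\<Sum>j\<in>S. (F j *\<^sub>v y) $ r)"
      using that assms carrier_matD[OF assms(1)] by (intro sum.cong) (auto simp: scalar_prod_def)
    finally show ?thesis .
  qed
  then have "y \<bullet> (mat_sum d d F S *\<^sub>v y) = (\<Sum>r=0..<d. \<Sum>j\<in>S. y $ r * (F j *\<^sub>v y) $ r)"
    by (simp add: scalar_prod_def mat_sum_def sum_distrib_left)
  also have "\<dots> = (\<Sum>j\<in>S. \<Sum>r=0..<d. y $ r * (F j *\<^sub>v y) $ r)" by (rule sum.swap)
  also have "\<dots> = (\<Sum>j\<in>S. y \<bullet> (F j *\<^sub>v y))"
    using carrier_matD[OF assms(1)] by (intro sum.cong) (auto simp: scalar_prod_def)
  finally show ?thesis .
qed

text \<open>The two off-diagonal blocks are transposes of each other, so their contributions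
  coincide and give the factor 2.\<close>

lemma four_block_quadratic_form:
  assumes P: "P \<in> carrier_mat a a" and C: "C \<in> carrier_mat a b" and Q: "Q \<in> carrier_mat b b"
    and u: "u \<in> carrier_vec a" and w: "w \<in> carrier_vec b"
  shows "(u @\<^sub>v w) \<bullet> (four_block_mat P C C\<^sup>T Q *\<^sub>v (u @\<^sub>v w))
    = u \<bullet> (P *\<^sub>v u) + 2 * (u \<bullet> (C *\<^sub>v w)) + w \<bullet> (Q *\<^sub>v (w :: real vec))"
proof -
  have CT: "C\<^sup>T \<in> carrier_mat b a" using C by simp
  have cc: "P *\<^sub>v u \<in> carrier_vec a" "C *\<^sub>v w \<in> carrier_vec a" "C\<^sup>T *\<^sub>v u \<in> carrier_vec b"
    "Q *\<^sub>v w \<in> carrier_vec b" using assms CT by auto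
  have "w \<bullet> (C\<^sup>T *\<^sub>v u) = u \<bullet> (C *\<^sub>v w)"
    using transpose_vec_mult_scalar[OF C w u] comm_scalar_prod[OF w cc(3)] by simp
  then show ?thesis
    unfolding four_block_mat_mult_vec[OF P C CT Q u w]
    using cc u w by (simp add: scalar_prod_append[of _ a _ b] scalar_prod_add_distrib[of _ a]
        scalar_prod_add_distrib[of _ b])
qed

text \<open>A positive definite matrix has trivial kernel, hence nonzero determinant, so
  \<open>mat_inverse\<close> returns \<open>Some\<close> and \<open>the\<close> yields a genuine
  inverse.\<close>

lemma pos_def_mat_inverse:
  assumes Z: "Z \<in> carrier_mat d d" and pd: "pos_def Z"
  shows "the (mat_inverse Z) \<in> carrier_mat d d" "the (mat_inverse Z) * Z = 1\<^sub>m d"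
proof -
  have "v = 0\<^sub>v d" if "v \<in> carrier_vec d" "Z *\<^sub>v v = 0\<^sub>v d" for v
    using that Z pd unfolding pos_def_def by force
  then have "det Z \<noteq> 0" using det_0_iff_vec_prod_zero_field[OF Z] by blast
  then have "Z \<in> Units (ring_mat TYPE(real) d ())" using det_non_zero_imp_unit[OF Z, of "()"] by blast
  then obtain Y where Y: "mat_inverse Z = Some Y" using mat_inverse(1)[OF Z] by fastforce
  then show "the (mat_inverse Z) \<in> carrier_mat d d" "the (mat_inverse Z) * Z = 1\<^sub>m d"
    using mat_inverse(2)[OF Z Y] by auto
qed

section \<open>From the matrix inequality to invariance of the terminal sets\<close>

theorem theorem2:
  fixes M i m :: nat and n :: "nat \<Rightarrow> nat" and N :: "nat \<Rightarrow> nat set"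
    and \<alpha> :: "nat \<Rightarrow> real" and Z :: "nat \<Rightarrow> real mat" and A B K :: "real mat"
  assumes "i \<in> {1..M}"
    and "\<And>j. j \<in> {1..M} \<Longrightarrow> N j \<subseteq> {1..M}"
    and "\<And>j. j \<in> {1..M} \<Longrightarrow> \<alpha> j > 0"
    and "\<And>j. j \<in> {1..M} \<Longrightarrow> Z j \<in> carrier_mat (n j) (n j)"
    and "\<And>j. j \<in> {1..M} \<Longrightarrow> pos_def (Z j)"
    and "A \<in> carrier_mat (n i) (\<Sum>j\<in>N i. n j)"
    and "B \<in> carrier_mat (n i) m"
    and "K \<in> carrier_mat m (\<Sum>j\<in>N i. n j)"
    and "\<exists>l :: nat \<Rightarrow> real. (\<forall>j\<in>N i. l j \<ge> 0) \<and>
      (let R = mat_sqrt (alpha_nbr M n \<alpha> (N i)); C = A * R + B * K * R; d = (\<Sum>j\<in>N i. n j) in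
        psd (four_block_mat
          (sqrt (\<alpha> i) \<cdot>\<^sub>m the (mat_inverse (Z i))) C
          C\<^sup>T (mat_sum d d (\<lambda>j. l j \<cdot>\<^sub>m Z_nbr M n Z (N i) j) (N i)))) \<and>
      (\<Sum>j\<in>N i. l j) \<le> sqrt (\<alpha> i)"
  shows "\<forall>x \<in> terminal_set_nbr n Z \<alpha> (N i). (A + B * K) *\<^sub>v x \<in> terminal_set (n i) (Z i) (\<alpha> i)"
proof
  fix x assume "x \<in> terminal_set_nbr n Z \<alpha> (N i)"
  then obtain \<xi> where x: "x = concat_states \<xi> (N i)"
    and \<xi>: "\<And>j. j \<in> N i \<Longrightarrow> \<xi> j \<in> carrier_vec (n j)"
      "\<And>j. j \<in> N i \<Longrightarrow> \<xi> j \<bullet> (Z j *\<^sub>v \<xi> j) \<le> \<alpha> j"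
    by (auto simp: terminal_set_nbr_def terminal_set_def)
  have sub: "N i \<subseteq> {1..M}" and fin: "finite (N i)"
    using assms(1,2) finite_subset by blast+
  define d where "d = (\<Sum>j\<in>N i. n j)"
  define R where "R = alpha_nbr M n (\<lambda>j. sqrt (\<alpha> j)) (N i)"
  define C where "C = A * R + B * K * R"
  define a where "a = sqrt (\<alpha> i)"
  have a: "a > 0" "\<alpha> i = a * a" using assms(1) assms(3)[of i] by (auto simp: a_def)
  have "mat_sqrt (alpha_nbr M n \<alpha> (N i)) = R"
    unfolding R_def using sub assms(3) by (intro mat_sqrt_alpha_nbr) auto
  then obtain l where l: "\<And>j. j \<in> N i \<Longrightarrow> l j \<ge> 0" "(\<Sum>j\<in>N i. l j) \<le> a"
    and psd: "psd (four_block_mat (a \<cdot>\<^sub>m the (mat_inverse (Z i))) C C\<^sup>T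
      (mat_sum d d (\<lambda>j. l j \<cdot>\<^sub>m Z_nbr M n Z (N i) j) (N i)))"
    using assms(9) unfolding Let_def C_def d_def a_def by auto
  let ?Y = "the (mat_inverse (Z i))"
  let ?Q = "mat_sum d d (\<lambda>j. l j \<cdot>\<^sub>m Z_nbr M n Z (N i) j) (N i)"
  have Z: "Z i \<in> carrier_mat (n i) (n i)" and Y: "?Y \<in> carrier_mat (n i) (n i)" "?Y * Z i = 1\<^sub>m (n i)"
    using assms(1,4,5) pos_def_mat_inverse[of "Z i" "n i"] by auto
  have A: "A \<in> carrier_mat (n i) d" and BK: "B * K \<in> carrier_mat (n i) d"
    and R: "R \<in> carrier_mat d d"
    using assms(6-8) alpha_nbr_carrier[OF fin, of M n] by (auto simp: d_def R_def)
  then have C: "C \<in> carrier_mat (n i) d" by (simp add: C_def)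
  have Q: "?Q \<in> carrier_mat d d" by (simp add: mat_sum_def)

  \<comment> \<open>Blockwise division by \<open>sqrt (\<alpha> j)\<close> solves
    \<open>R y = x\<close> without inverting \<open>R\<close>.\<close>
  define \<eta> where "\<eta> j = (1 / sqrt (\<alpha> j)) \<cdot>\<^sub>v \<xi> j" for j
  define y where "y = concat_states \<eta> (N i)"
  have \<eta>: "\<eta> j \<in> carrier_vec (n j)" if "j \<in> N i" for j using that \<xi> by (simp add: \<eta>_def)
  then have y: "y \<in> carrier_vec d"
    unfolding y_def d_def using fin by (intro concat_states_carrier) auto
  have "R *\<^sub>v y = concat_states (\<lambda>j. sqrt (\<alpha> j) \<cdot>\<^sub>v \<eta> j) (N i)"
    unfolding R_def y_def using sub \<eta> by (intro alpha_nbr_concat_states) auto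
  also have "\<dots> = x"
    unfolding x concat_states_eq_stack
  proof (rule stack_cong)
    fix j assume "j \<in> set (sorted_list_of_set (N i))"
    then have "\<alpha> j > 0" using sub fin assms(3)[of j] by auto
    then show "sqrt (\<alpha> j) \<cdot>\<^sub>v \<eta> j = \<xi> j" by (simp add: \<eta>_def smult_smult_assoc)
  qed
  finally have Ry: "R *\<^sub>v y = x" .
  define z where "z = (A + B * K) *\<^sub>v x"
  have xc: "x \<in> carrier_vec d" using Ry R y by auto
  have ABK: "A + B * K \<in> carrier_mat (n i) d" using BK by (rule add_carrier_mat)
  then have z: "z \<in> carrier_vec (n i)" unfolding z_def using xc by (rule mult_mat_vec_carrier)
  have Cy: "C *\<^sub>v y = z"
  proof -
    have "C = (A + B * K) * R"
      unfolding C_def using A BK R by (simp add: add_mult_distrib_mat)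
    then show ?thesis unfolding z_def Ry[symmetric] using assoc_mult_mat_vec[OF ABK R y] by simp
  qed

  \<comment> \<open>Each neighbor contributes at most 1 after rescaling, so the nonnegative
    multipliers \<open>l j\<close> bound the form by their sum, which is at most
    \<open>a\<close>.\<close>
  have Qy: "y \<bullet> (?Q *\<^sub>v y) \<le> a"
  proof -
    have "y \<bullet> (?Q *\<^sub>v y) = (\<Sum>j\<in>N i. y \<bullet> ((l j \<cdot>\<^sub>m Z_nbr M n Z (N i) j) *\<^sub>v y))"
      using Z_nbr_carrier[OF fin] y by (intro mat_sum_quadratic_form) (auto simp: d_def)
    also have "\<dots> \<le> (\<Sum>j\<in>N i. l j)"
    proof (rule sum_mono)
      fix j assume j: "j \<in> N i"
      have Zj: "Z j \<in> carrier_mat (n j) (n j)" and \<alpha>j: "\<alpha> j > 0" using j sub assms(3,4) by auto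
      have Zn: "Z_nbr M n Z (N i) j \<in> carrier_mat d d"
        using Z_nbr_carrier[OF fin] by (simp add: d_def)
      have "y \<bullet> (Z_nbr M n Z (N i) j *\<^sub>v y) = \<eta> j \<bullet> (Z j *\<^sub>v \<eta> j)"
        unfolding y_def using sub \<eta> j Zj by (intro Z_nbr_quadratic_form) auto
      also have "\<dots> = (\<xi> j \<bullet> (Z j *\<^sub>v \<xi> j)) / \<alpha> j"
        using \<xi>(1)[OF j] Zj \<alpha>j
        by (simp add: \<eta>_def mult_mat_vec[OF Zj] scalar_prod_smult_distrib[of _ "n j"]
            smult_scalar_prod_distrib[of _ "n j"] flip: real_sqrt_mult)
      also have "\<dots> \<le> 1" using \<xi>(2)[OF j] \<alpha>j by simp
      finally have le: "y \<bullet> (Z_nbr M n Z (N i) j *\<^sub>v y) \<le> 1" .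
      have "(l j \<cdot>\<^sub>m Z_nbr M n Z (N i) j) *\<^sub>v y = l j \<cdot>\<^sub>v (Z_nbr M n Z (N i) j *\<^sub>v y)"
        using Zn y by (intro eq_vecI) auto
      then have "y \<bullet> ((l j \<cdot>\<^sub>m Z_nbr M n Z (N i) j) *\<^sub>v y) = l j * (y \<bullet> (Z_nbr M n Z (N i) j *\<^sub>v y))"
        using y Zn by (simp add: scalar_prod_smult_distrib[of _ d])
      then show "y \<bullet> ((l j \<cdot>\<^sub>m Z_nbr M n Z (N i) j) *\<^sub>v y) \<le> l j"
        using mult_left_mono[OF le l(1)[OF j]] by simp
    qed
    finally show ?thesis using l(2) by simp
  qed

  define q where "q = z \<bullet> (Z i *\<^sub>v z)"
  \<comment> \<open>The first component cancels the inverse of \<open>Z i\<close>. With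
    \<open>- s y\<close> as second component, the inequality becomes
    \<open>0 \<le> (a - 2 * s) * q + s * s * a\<close>; among \<open>s > a / 2\<close>, the choice
    \<open>s = a\<close> gives the sharpest bound on \<open>q\<close>.\<close>
  let ?u = "Z i *\<^sub>v z" and ?w = "(- a) \<cdot>\<^sub>v y"
  have u: "?u \<in> carrier_vec (n i)" and w: "?w \<in> carrier_vec d" using Z z y by auto
  have uz: "?u \<bullet> z = q" using comm_scalar_prod[OF u z] by (simp add: q_def)
  have "?Y *\<^sub>v ?u = z"
    using assoc_mult_mat_vec[OF Y(1) Z z] Y(2) z by simp
  moreover have "(a \<cdot>\<^sub>m ?Y) *\<^sub>v ?u = a \<cdot>\<^sub>v (?Y *\<^sub>v ?u)"
    using Y(1) u by (intro eq_vecI) (auto simp: smult_scalar_prod_distrib[of _ "n i"])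
  ultimately have t1: "?u \<bullet> ((a \<cdot>\<^sub>m ?Y) *\<^sub>v ?u) = a * q"
    using u z uz by (simp add: scalar_prod_smult_distrib[of _ "n i"])
  have t2: "?u \<bullet> (C *\<^sub>v ?w) = - a * q"
    unfolding mult_mat_vec[OF C y] Cy using u z uz by (simp add: scalar_prod_smult_distrib[of _ "n i"])
  have t3: "?w \<bullet> (?Q *\<^sub>v ?w) = a * a * (y \<bullet> (?Q *\<^sub>v y))"
    unfolding mult_mat_vec[OF Q y] using Q y
    by (simp add: scalar_prod_smult_distrib[of _ d] smult_scalar_prod_distrib[of _ d])
  have "0 \<le> (?u @\<^sub>v ?w) \<bullet> (four_block_mat (a \<cdot>\<^sub>m ?Y) C C\<^sup>T ?Q *\<^sub>v (?u @\<^sub>v ?w))"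
    using psd u w Y Q unfolding psd_def by auto
  also have "\<dots> = a * q + 2 * (- a * q) + a * a * (y \<bullet> (?Q *\<^sub>v y))"
    using four_block_quadratic_form[OF _ C Q u w, of "a \<cdot>\<^sub>m ?Y"] Y(1) t1 t2 t3 by simp
  \<comment> \<open>This is \<open>Qy\<close> multiplied by the positive factor
    \<open>a * a\<close>; cancelling one factor \<open>a\<close> afterwards leaves
    \<open>q \<le> a * a\<close>.\<close>
  also have "\<dots> \<le> a * q + 2 * (- a * q) + a * a * a"
    using Qy a by simp
  finally have "a * q \<le> a * (a * a)" by (simp add: algebra_simps)
  then have "q \<le> \<alpha> i" using a by simp
  then show "(A + B * K) *\<^sub>v x \<in> terminal_set (n i) (Z i) (\<alpha> i)"
    using z by (simp add: terminal_set_def z_def q_def)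
qed

end
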